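(* Let $f\colon P\twoheadrightarrow Q$ be an operator-reduced quandle homomorphism. Assume that there are a finite sequence $1=N_0\subseteq N_1\subseteq\cdots\subseteq N_d=\mathrm{Inn}_{\mathrm{rel}}(f)$ of normal subgroups of $\mathrm{Inn}(P)$ and an integer $r$ such that, for each $1\le j\le d$, the quotient $A_j=N_j/N_{j-1}$ is abelian and the image of the conjugation action $\alpha_j\colon\mathrm{Inn}(P)\to\mathrm{Aut}(A_j)$ is abelian and generated by finitely many elements of the form $\alpha_j(s_{x_1}),\dots,\alpha_j(s_{x_r})$ for some $x_1,\dots,x_r\in P$. Then $f$ is nilpotent of class at most $d(r+1)$.
   Context: A quandle is a set $Q$ with a map $s_x\colon Q\to Q$ for each $x\in Q$ such that, for all $x,y\in Q$, $s_x(x)=x$, $s_x$ is bijective, and $s_x\circ s_y=s_{s_x(y)}\circ s_x$. A quandle homomorphism is a map $f\colon P\to Q$ with $f\circ s_x=s_{f(x)}\circ f$ for all $x\in P$. The inner automorphism group $\mathrm{Inn}(Q)$ is the subgroup of $\mathrm{Aut}(Q)$ generated by all $s_x$. For a surjective quandle homomorphism $f\colon P\twoheadrightarrow Q$ there is a unique surjective group homomorphism $f_*\colon\mathrm{Inn}(P)\to\mathrm{Inn}(Q)$ with $f_*(s_x)=s_{f(x)}$; put $\mathrm{Inn}_{\mathrm{rel}}(f)=\mathrm{Ker}(f_* )$. For subgroups $A,B$ of a group, $[A,B]$ is the subgroup generated by all $[a,b]=aba^{-1}b^{-1}$. For $N\trianglelefteq G$ put $\Gamma_0(G,N)=N$,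 $\Gamma_{i+1}(G,N)=[G,\Gamma_i(G,N)]$. The surjective homomorphism $f$ is nilpotent of class at most $c$ if $\Gamma_c(\mathrm{Inn}(P),\mathrm{Inn}_{\mathrm{rel}}(f))=1$. It is operator-reduced if it is surjective and $s_xs_{\varphi(x)}=s_{\varphi(x)}s_x$ for every $x\in P$ and every $\varphi\in\mathrm{Inn}_{\mathrm{rel}}(f)$. *)

theory Defs
  imports "HOL-Algebra.Algebra"
begin

section \<open>Quandles\<close>

record 'a qdl = "'a partial_object" +
  qsym :: "'a \<Rightarrow> 'a \<Rightarrow> 'a"

text \<open>\<open>qsym Q x\<close> is the map \<open>s\<^sub>x\<close>; only its values on \<open>carrier Q\<close> matter.\<close>

locale quandle =
  fixes Q :: "('a, 'm) qdl_scheme"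
  assumes qsym_self: "x \<in> carrier Q \<Longrightarrow> qsym Q x x = x"
    and qsym_bij: "x \<in> carrier Q \<Longrightarrow> bij_betw (qsym Q x) (carrier Q) (carrier Q)"
    and qsym_distrib: "\<lbrakk>x \<in> carrier Q; y \<in> carrier Q; z \<in> carrier Q\<rbrakk> \<Longrightarrow>
          qsym Q x (qsym Q y z) = qsym Q (qsym Q x y) (qsym Q x z)"

definition quandle_hom :: "('a, 'm) qdl_scheme \<Rightarrow> ('b, 'n) qdl_scheme \<Rightarrow> ('a \<Rightarrow> 'b) set" where
  "quandle_hom P Q = {f \<in> carrier P \<rightarrow> carrier Q.
     \<forall>x\<in>carrier P. \<forall>y\<in>carrier P. f (qsym P x y) = qsym Q (f x) (f y)}"

definition quandle_epi :: "('a, 'm) qdl_scheme \<Rightarrow> ('b, 'n) qdl_scheme \<Rightarrow> ('a \<Rightarrow> 'b) \<Rightarrow> bool" where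
  "quandle_epi P Q f \<longleftrightarrow>
     quandle P \<and> quandle Q \<and> f \<in> quandle_hom P Q \<and> f ` carrier P = carrier Q"

text \<open>As in \<open>BijGroup\<close>, permutations of the carrier are represented by extensional functions,
  so \<open>s\<^sub>x\<close> has to be restricted to the carrier to become an element of the automorphism group.\<close>

definition sym_perm :: "('a, 'm) qdl_scheme \<Rightarrow> 'a \<Rightarrow> ('a \<Rightarrow> 'a)" where
  "sym_perm Q x = restrict (qsym Q x) (carrier Q)"

definition quandle_Aut :: "('a, 'm) qdl_scheme \<Rightarrow> ('a \<Rightarrow> 'a) monoid" where
  "quandle_Aut Q = BijGroup (carrier Q)\<lparr>carrier := quandle_hom Q Q \<inter> Bij (carrier Q)\<rparr>"

definition Inn :: "('a, 'm) qdl_scheme \<Rightarrow> ('a \<Rightarrow> 'a) monoid" where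
  "Inn Q = subgroup_generated (quandle_Aut Q) (sym_perm Q ` carrier Q)"

text \<open>The homomorphism \<open>f\<^sub>*\<close>. It is made extensional so that it is unique as a HOL function;
  existence and uniqueness are proved below as \<open>ex1_Inn_map\<close>.\<close>

definition is_Inn_map ::
    "('a, 'm) qdl_scheme \<Rightarrow> ('b, 'n) qdl_scheme \<Rightarrow> ('a \<Rightarrow> 'b) \<Rightarrow> (('a \<Rightarrow> 'a) \<Rightarrow> ('b \<Rightarrow> 'b)) \<Rightarrow> bool" where
  "is_Inn_map P Q f h \<longleftrightarrow>
     h \<in> extensional (carrier (Inn P)) \<and> h \<in> epi (Inn P) (Inn Q) \<and>
     (\<forall>x\<in>carrier P. h (sym_perm P x) = sym_perm Q (f x))"

definition Inn_map ::
    "('a, 'm) qdl_scheme \<Rightarrow> ('b, 'n) qdl_scheme \<Rightarrow> ('a \<Rightarrow> 'b) \<Rightarrow> ('a \<Rightarrow> 'a) \<Rightarrow> ('b \<Rightarrow> 'b)" where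
  "Inn_map P Q f = (THE h. is_Inn_map P Q f h)"

lemma (in quandle) qsym_closed: "x \<in> carrier Q \<Longrightarrow> y \<in> carrier Q \<Longrightarrow> qsym Q x y \<in> carrier Q"
  using qsym_bij bij_betwE by metis

lemma (in quandle) group_quandle_Aut: "group (quandle_Aut Q)"
proof -
  let ?A = "quandle_hom Q Q \<inter> Bij (carrier Q)"
  have "subgroup ?A (BijGroup (carrier Q))"
  proof (rule subgroup.intro)
    show "?A \<subseteq> carrier (BijGroup (carrier Q))"
      by (auto simp: BijGroup_def)
    show "\<one>\<^bsub>BijGroup (carrier Q)\<^esub> \<in> ?A"
      using qsym_closed by (auto simp: BijGroup_def id_Bij quandle_hom_def)
  next
    fix g h assume "g \<in> ?A" "h \<in> ?A"
    then show "g \<otimes>\<^bsub>BijGroup (carrier Q)\<^esub> h \<in> ?A"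
      using qsym_closed compose_Bij[of g "carrier Q" h]
      by (auto simp: BijGroup_def quandle_hom_def compose_def Pi_iff)
  next
    fix g assume g: "g \<in> ?A"
    have *: "qsym Q \<in> carrier Q \<rightarrow> carrier Q \<rightarrow> carrier Q"
      using qsym_closed by auto
    have "inv_into (carrier Q) g (qsym Q x y) =
            qsym Q (inv_into (carrier Q) g x) (inv_into (carrier Q) g y)"
      if "x \<in> carrier Q" "y \<in> carrier Q" for x y
      using g that * by (intro Bij_inv_into_lemma) (auto simp: quandle_hom_def)
    then show "inv\<^bsub>BijGroup (carrier Q)\<^esub> g \<in> ?A"
      using g qsym_closed
      by (auto simp: inv_BijGroup restrict_inv_into_Bij quandle_hom_def Bij_inv_into_mem)
  qed
  then show ?thesis
    by (simp add: quandle_Aut_def subgroup.subgroup_is_group group_BijGroup)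
qed

lemma (in quandle) sym_perm_in_Aut:
  assumes "x \<in> carrier Q" shows "sym_perm Q x \<in> carrier (quandle_Aut Q)"
proof -
  have "bij_betw (sym_perm Q x) (carrier Q) (carrier Q)"
    using qsym_bij[OF assms] by (simp add: sym_perm_def cong: bij_betw_cong)
  moreover have "sym_perm Q x \<in> quandle_hom Q Q"
    using assms qsym_closed by (simp add: quandle_hom_def sym_perm_def Pi_iff) (metis qsym_distrib)
  ultimately show ?thesis
    by (simp add: quandle_Aut_def Bij_def) (simp add: sym_perm_def)
qed

lemma (in quandle) group_Inn: "group (Inn Q)"
  by (simp add: Inn_def group.group_subgroup_generated group_quandle_Aut)

lemma (in quandle) carrier_Inn:
  "carrier (Inn Q) = generate (quandle_Aut Q) (sym_perm Q ` carrier Q)"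
  using sym_perm_in_Aut by (simp add: Inn_def carrier_subgroup_generated Int_absorb1 image_subsetI)

lemma (in quandle) sym_perm_in_Inn: "x \<in> carrier Q \<Longrightarrow> sym_perm Q x \<in> carrier (Inn Q)"
  by (simp add: carrier_Inn generate.incl)

lemma (in quandle) Inn_subset_Aut: "carrier (Inn Q) \<subseteq> carrier (quandle_Aut Q)"
  using group.carrier_subgroup_generated_subset[OF group_quandle_Aut] by (simp add: Inn_def)

lemma (in quandle) Inn_in_Bij: "\<phi> \<in> carrier (Inn Q) \<Longrightarrow> \<phi> \<in> Bij (carrier Q)"
  using Inn_subset_Aut by (auto simp: quandle_Aut_def)

lemma (in quandle) Inn_mult:
  assumes "\<phi> \<in> carrier (Inn Q)" "\<psi> \<in> carrier (Inn Q)"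
  shows "\<phi> \<otimes>\<^bsub>Inn Q\<^esub> \<psi> = compose (carrier Q) \<phi> \<psi>"
  using Inn_in_Bij[OF assms(1)] Inn_in_Bij[OF assms(2)]
  by (simp add: Inn_def quandle_Aut_def BijGroup_def)

lemma (in quandle) Inn_one: "\<one>\<^bsub>Inn Q\<^esub> = (\<lambda>x\<in>carrier Q. x)"
  by (simp add: Inn_def quandle_Aut_def BijGroup_def)

lemma (in quandle) Inn_induct [consumes 1, case_names one sym inv mult]:
  assumes "\<phi> \<in> carrier (Inn Q)"
    and "R \<one>\<^bsub>Inn Q\<^esub>"
    and "\<And>x. x \<in> carrier Q \<Longrightarrow> R (sym_perm Q x)"
    and "\<And>x. x \<in> carrier Q \<Longrightarrow> R (inv\<^bsub>Inn Q\<^esub> (sym_perm Q x))"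
    and "\<And>\<phi> \<psi>. \<lbrakk>\<phi> \<in> carrier (Inn Q); \<psi> \<in> carrier (Inn Q); R \<phi>; R \<psi>\<rbrakk> \<Longrightarrow> R (\<phi> \<otimes>\<^bsub>Inn Q\<^esub> \<psi>)"
  shows "R \<phi>"
proof -
  have inv_eq: "inv\<^bsub>Inn Q\<^esub> (sym_perm Q x) = inv\<^bsub>quandle_Aut Q\<^esub> (sym_perm Q x)"
    if "x \<in> carrier Q" for x
    using sym_perm_in_Inn[OF that] unfolding Inn_def
    by (rule group.inv_subgroup_generated[OF group_quandle_Aut])
  have "\<phi> \<in> generate (quandle_Aut Q) (sym_perm Q ` carrier Q)"
    using assms(1) by (simp add: carrier_Inn)
  then show ?thesis
  proof (induction rule: generate.induct)
    case one
    then show ?case using assms(2) by (simp add: Inn_def)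
  next
    case (incl h)
    then show ?case using assms(3) by auto
  next
    case (inv h)
    then show ?case using assms(4) inv_eq by force
  next
    case (eng h1 h2)
    then show ?case using assms(5)[of h1 h2] by (simp add: carrier_Inn) (simp add: Inn_def)
  qed
qed

text \<open>\<open>f\<^sub>* \<phi>\<close> is characterised by \<open>f\<^sub>* \<phi> \<circ> f = f \<circ> \<phi>\<close>.\<close>

lemma ex1_Inn_map_value:
  assumes "quandle_epi P Q f" "\<phi> \<in> carrier (Inn P)"
  shows "\<exists>!\<psi>. \<psi> \<in> carrier (Inn Q) \<and> (\<forall>y\<in>carrier P. \<psi> (f y) = f (\<phi> y))"
proof -
  interpret P: quandle P using assms(1) by (simp add: quandle_epi_def)
  interpret Q: quandle Q using assms(1) by (simp add: quandle_epi_def)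
  interpret GP: group "Inn P" by (rule P.group_Inn)
  interpret GQ: group "Inn Q" by (rule Q.group_Inn)
  have f: "f y \<in> carrier Q" if "y \<in> carrier P" for y
    using assms(1) that by (auto simp: quandle_epi_def)
  have hom: "f (qsym P x y) = qsym Q (f x) (f y)" if "x \<in> carrier P" "y \<in> carrier P" for x y
    using assms(1) that by (auto simp: quandle_epi_def quandle_hom_def)
  have surj: "carrier Q = f ` carrier P"
    using assms(1) by (simp add: quandle_epi_def)
  have ap: "\<phi> y \<in> carrier P" if "\<phi> \<in> carrier (Inn P)" "y \<in> carrier P" for \<phi> y
    using Bij_imp_funcset[OF P.Inn_in_Bij[OF that(1)]] that(2) by auto
  have "\<exists>\<psi>. \<psi> \<in> carrier (Inn Q) \<and> (\<forall>y\<in>carrier P. \<psi> (f y) = f (\<phi> y))"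
    using assms(2)
  proof (induction rule: P.Inn_induct)
    case one
    have "\<forall>y\<in>carrier P. \<one>\<^bsub>Inn Q\<^esub> (f y) = f (\<one>\<^bsub>Inn P\<^esub> y)"
      using f by (simp add: P.Inn_one Q.Inn_one)
    then show ?case using GQ.one_closed by blast
  next
    case (sym x)
    then have "\<forall>y\<in>carrier P. sym_perm Q (f x) (f y) = f (sym_perm P x y)"
      using f hom by (simp add: sym_perm_def)
    then show ?case using f[OF sym] Q.sym_perm_in_Inn by blast
  next
    case (inv x)
    let ?s = "sym_perm P x" and ?t = "sym_perm Q (f x)"
    have s: "?s \<in> carrier (Inn P)" and t: "?t \<in> carrier (Inn Q)"
      using inv f P.sym_perm_in_Inn Q.sym_perm_in_Inn by auto
    have "(inv\<^bsub>Inn Q\<^esub> ?t) (f y) = f ((inv\<^bsub>Inn P\<^esub> ?s) y)" if y: "y \<in> carrier P" for y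
    proof -
      let ?z = "(inv\<^bsub>Inn P\<^esub> ?s) y"
      have z: "?z \<in> carrier P" using ap s y by simp
      have "compose (carrier P) ?s (inv\<^bsub>Inn P\<^esub> ?s) = (\<lambda>x\<in>carrier P. x)"
        using GP.r_inv[OF s] P.Inn_mult[OF s GP.inv_closed[OF s]] by (simp add: P.Inn_one)
      from fun_cong[OF this, of y] have 1: "?s ?z = y" using y by (simp add: compose_def)
      have "compose (carrier Q) (inv\<^bsub>Inn Q\<^esub> ?t) ?t = (\<lambda>x\<in>carrier Q. x)"
        using GQ.l_inv[OF t] Q.Inn_mult[OF GQ.inv_closed[OF t] t] by (simp add: Q.Inn_one)
      from fun_cong[OF this, of "f ?z"] have 2: "(inv\<^bsub>Inn Q\<^esub> ?t) (?t (f ?z)) = f ?z"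
        using f z by (simp add: compose_def)
      have "?t (f ?z) = f y" using 1 hom[OF inv z] z f by (simp add: sym_perm_def)
      then show ?thesis using 2 by simp
    qed
    then show ?case using t by (intro exI[of _ "inv\<^bsub>Inn Q\<^esub> ?t"]) simp
  next
    case (mult \<phi>1 \<phi>2)
    then obtain \<psi>1 \<psi>2 where \<psi>: "\<psi>1 \<in> carrier (Inn Q)" "\<psi>2 \<in> carrier (Inn Q)"
      "\<forall>y\<in>carrier P. \<psi>1 (f y) = f (\<phi>1 y)" "\<forall>y\<in>carrier P. \<psi>2 (f y) = f (\<phi>2 y)"
      by blast
    then have "\<forall>y\<in>carrier P. (\<psi>1 \<otimes>\<^bsub>Inn Q\<^esub> \<psi>2) (f y) = f ((\<phi>1 \<otimes>\<^bsub>Inn P\<^esub> \<phi>2) y)"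
      using mult(1,2) f ap by (simp add: P.Inn_mult Q.Inn_mult compose_def)
    then show ?case using \<psi>(1,2) GQ.m_closed by blast
  qed
  moreover have "\<psi> = \<psi>'"
    if "\<psi> \<in> carrier (Inn Q)" "\<forall>y\<in>carrier P. \<psi> (f y) = f (\<phi> y)"
       "\<psi>' \<in> carrier (Inn Q)" "\<forall>y\<in>carrier P. \<psi>' (f y) = f (\<phi> y)" for \<psi> \<psi>'
    using that
    by (intro extensionalityI[OF Bij_imp_extensional[OF Q.Inn_in_Bij]
          Bij_imp_extensional[OF Q.Inn_in_Bij]]) (auto simp: surj)
  ultimately show ?thesis by blast
qed

lemma ex1_Inn_map:
  assumes "quandle_epi P Q f"
  shows "\<exists>!h. is_Inn_map P Q f h"
proof -
  interpret P: quandle P using assms(1) by (simp add: quandle_epi_def)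
  interpret Q: quandle Q using assms(1) by (simp add: quandle_epi_def)
  interpret GP: group "Inn P" by (rule P.group_Inn)
  interpret GQ: group "Inn Q" by (rule Q.group_Inn)
  have f: "f y \<in> carrier Q" if "y \<in> carrier P" for y
    using assms(1) that by (auto simp: quandle_epi_def)
  have fhom: "f (qsym P x y) = qsym Q (f x) (f y)" if "x \<in> carrier P" "y \<in> carrier P" for x y
    using assms(1) that by (auto simp: quandle_epi_def quandle_hom_def)
  have surj: "carrier Q = f ` carrier P"
    using assms(1) by (simp add: quandle_epi_def)
  have ap: "\<phi> y \<in> carrier P" if "\<phi> \<in> carrier (Inn P)" "y \<in> carrier P" for \<phi> y
    using Bij_imp_funcset[OF P.Inn_in_Bij[OF that(1)]] that(2) by auto
  let ?R = "\<lambda>\<phi> \<psi>. \<psi> \<in> carrier (Inn Q) \<and> (\<forall>y\<in>carrier P. \<psi> (f y) = f (\<phi> y))"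
  define h where "h = (\<lambda>\<phi>\<in>carrier (Inn P). THE \<psi>. ?R \<phi> \<psi>)"
  have h: "?R \<phi> (h \<phi>)" if "\<phi> \<in> carrier (Inn P)" for \<phi>
    using theI'[OF ex1_Inn_map_value[OF assms that]] that by (simp add: h_def)
  have hu: "h \<phi> = \<psi>" if "\<phi> \<in> carrier (Inn P)" "?R \<phi> \<psi>" for \<phi> \<psi>
    using ex1_Inn_map_value[OF assms that(1)] h[OF that(1)] that(2) by blast
  have hom: "h \<in> hom (Inn P) (Inn Q)"
  proof (rule homI)
    fix \<phi> \<psi> assume *: "\<phi> \<in> carrier (Inn P)" "\<psi> \<in> carrier (Inn P)"
    have "h \<phi> \<in> carrier (Inn Q)" "h \<psi> \<in> carrier (Inn Q)" using h * by auto
    then show "h (\<phi> \<otimes>\<^bsub>Inn P\<^esub> \<psi>) = h \<phi> \<otimes>\<^bsub>Inn Q\<^esub> h \<psi>"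
      using * h f ap GP.m_closed[OF *] GQ.m_closed[of "h \<phi>" "h \<psi>"]
      by (intro hu) (simp_all add: P.Inn_mult Q.Inn_mult compose_def)
  qed (use h in blast)
  have h_sym: "h (sym_perm P x) = sym_perm Q (f x)" if "x \<in> carrier P" for x
    using that f fhom P.sym_perm_in_Inn Q.sym_perm_in_Inn
    by (intro hu) (simp_all add: sym_perm_def)
  interpret h: group_hom "Inn P" "Inn Q" h
    using hom by unfold_locales
  have "\<psi> \<in> h ` carrier (Inn P)" if "\<psi> \<in> carrier (Inn Q)" for \<psi>
    using that
  proof (induction rule: Q.Inn_induct)
    case one
    then show ?case using h.hom_one GP.one_closed by (metis imageI)
  next
    case (sym x)
    then obtain y where "y \<in> carrier P" "x = f y" using surj by auto
    then show ?case using h_sym P.sym_perm_in_Inn by (metis imageI)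
  next
    case (inv x)
    then obtain y where "y \<in> carrier P" "x = f y" using surj by auto
    then show ?case using h_sym P.sym_perm_in_Inn h.hom_inv GP.inv_closed by (metis imageI)
  next
    case (mult \<phi> \<psi>)
    then obtain \<phi>' \<psi>' where "\<phi>' \<in> carrier (Inn P)" "\<psi>' \<in> carrier (Inn P)" "\<phi> = h \<phi>'" "\<psi> = h \<psi>'"
      by blast
    then show ?case by (intro image_eqI[of _ _ "\<phi>' \<otimes>\<^bsub>Inn P\<^esub> \<psi>'"]) simp_all
  qed
  then have "is_Inn_map P Q f h"
    using h hom h_sym by (auto simp: is_Inn_map_def epi_def h_def)
  moreover have "g \<phi> = h \<phi>" if "is_Inn_map P Q f g" "\<phi> \<in> carrier (Inn P)" for g \<phi>
  proof -
    interpret g: group_hom "Inn P" "Inn Q" g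
      using that(1) by unfold_locales (auto simp: is_Inn_map_def epi_def)
    have g: "g (sym_perm P x) = h (sym_perm P x)" if "x \<in> carrier P" for x
      using \<open>is_Inn_map P Q f g\<close> that h_sym by (simp add: is_Inn_map_def)
    show ?thesis using that(2)
      by (induction rule: P.Inn_induct) (simp_all add: g P.sym_perm_in_Inn)
  qed
  ultimately show ?thesis
    by (intro ex1I[of _ h]) (auto simp: is_Inn_map_def intro: extensionalityI)
qed

lemma is_Inn_map_Inn_map: "quandle_epi P Q f \<Longrightarrow> is_Inn_map P Q f (Inn_map P Q f)"
  unfolding Inn_map_def by (rule theI'[OF ex1_Inn_map])

definition Inn_rel ::
    "('a, 'm) qdl_scheme \<Rightarrow> ('b, 'n) qdl_scheme \<Rightarrow> ('a \<Rightarrow> 'b) \<Rightarrow> ('a \<Rightarrow> 'a) set" where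
  "Inn_rel P Q f = kernel (Inn P) (Inn Q) (Inn_map P Q f)"


section \<open>Nilpotency and operator-reducedness\<close>

definition commutator_subgroup :: "('g, 'm) monoid_scheme \<Rightarrow> 'g set \<Rightarrow> 'g set \<Rightarrow> 'g set" where
  "commutator_subgroup G A B = generate G
     (\<Union>a\<in>A. \<Union>b\<in>B. {a \<otimes>\<^bsub>G\<^esub> b \<otimes>\<^bsub>G\<^esub> inv\<^bsub>G\<^esub> a \<otimes>\<^bsub>G\<^esub> inv\<^bsub>G\<^esub> b})"

primrec rel_lower_central :: "('g, 'm) monoid_scheme \<Rightarrow> 'g set \<Rightarrow> nat \<Rightarrow> 'g set" where
  "rel_lower_central G N 0 = N"
| "rel_lower_central G N (Suc i) = commutator_subgroup G (carrier G) (rel_lower_central G N i)"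

definition nilpotent_of_class_le ::
    "('a, 'm) qdl_scheme \<Rightarrow> ('b, 'n) qdl_scheme \<Rightarrow> ('a \<Rightarrow> 'b) \<Rightarrow> nat \<Rightarrow> bool" where
  "nilpotent_of_class_le P Q f c \<longleftrightarrow>
     quandle_epi P Q f \<and> rel_lower_central (Inn P) (Inn_rel P Q f) c = {\<one>\<^bsub>Inn P\<^esub>}"

definition operator_reduced ::
    "('a, 'm) qdl_scheme \<Rightarrow> ('b, 'n) qdl_scheme \<Rightarrow> ('a \<Rightarrow> 'b) \<Rightarrow> bool" where
  "operator_reduced P Q f \<longleftrightarrow>
     quandle_epi P Q f \<and>
     (\<forall>x\<in>carrier P. \<forall>\<phi>\<in>Inn_rel P Q f.
        sym_perm P x \<otimes>\<^bsub>Inn P\<^esub> sym_perm P (\<phi> x) = sym_perm P (\<phi> x) \<otimes>\<^bsub>Inn P\<^esub> sym_perm P x)"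


section \<open>The conjugation action on a subquotient\<close>

definition subquotient :: "('g, 'm) monoid_scheme \<Rightarrow> 'g set \<Rightarrow> 'g set \<Rightarrow> 'g set monoid" where
  "subquotient G N M = G\<lparr>carrier := N\<rparr> Mod M"

text \<open>The element \<open>g\<close> acts on \<open>N/M\<close> by sending a coset \<open>C\<close> to \<open>g C g\<^sup>-\<^sup>1\<close>, i.e.\ the coset
  of \<open>n\<close> to that of \<open>g n g\<^sup>-\<^sup>1\<close>; for \<open>M\<close>, \<open>N\<close> normal in \<open>G\<close> this lies in
  \<open>AutoGroup (subquotient G N M)\<close>.\<close>

definition conj_action ::
    "('g, 'm) monoid_scheme \<Rightarrow> 'g set \<Rightarrow> 'g set \<Rightarrow> 'g \<Rightarrow> ('g set \<Rightarrow> 'g set)" where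
  "conj_action G N M g =
     (\<lambda>C\<in>carrier (subquotient G N M). (g <#\<^bsub>G\<^esub> C) #>\<^bsub>G\<^esub> inv\<^bsub>G\<^esub> g)"

end

theory Submission
  imports Defs
begin

text \<open>
  For \<open>\<phi> \<in> N\<^sub>j\<close> and \<open>s = s\<^sub>x\<close> the element \<open>s\<^bsub>\<phi>(x)\<^esub> = \<phi> s \<phi>\<^sup>-\<^sup>1\<close> commutes with \<open>s\<close>, so \<open>s\<close> commutes
  with the commutator of \<open>s\<close> and \<open>\<phi>\<close>. Written additively, \<open>T = \<alpha>\<^sub>j(s)\<close> therefore satisfies
  \<open>(T - 1)\<^sup>2 = 0\<close> on \<open>A\<^sub>j\<close>. As the image of \<open>\<alpha>\<^sub>j\<close> is commutative and generated by \<open>r\<close> such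
  operators, any product of \<open>r + 1\<close> factors \<open>T\<^sub>i - 1\<close> repeats a factor and vanishes, so \<open>r + 1\<close>
  commutation steps lead from \<open>N\<^sub>j\<close> into \<open>N\<^bsub>j-1\<^esub>\<close>.
\<close>

section \<open>Iterated fixed points of a set of automorphisms\<close>

text \<open>Additively, level \<open>k\<close> consists of the elements killed by all products of
  \<open>k\<close> operators \<open>h - 1\<close> with \<open>h\<close> in \<open>H\<close>: an
  upper central series of \<open>A\<close> relative to \<open>H\<close>. All of \<open>H\<close> is
  tested, not only generators, so that for the conjugation action the condition concerns commutators
  with every group element.\<close>

primrec upper_fixed :: "('g, 'm) monoid_scheme \<Rightarrow> ('g \<Rightarrow> 'g) set \<Rightarrow> nat \<Rightarrow> 'g set" where
  "upper_fixed A H 0 = {\<one>\<^bsub>A\<^esub>}"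
| "upper_fixed A H (Suc k) =
     {a \<in> carrier A. \<forall>h\<in>H. h a \<otimes>\<^bsub>A\<^esub> inv\<^bsub>A\<^esub> a \<in> upper_fixed A H k}"

lemma auto_closed: "h \<in> auto A \<Longrightarrow> a \<in> carrier A \<Longrightarrow> h a \<in> carrier A"
  by (auto simp: auto_def hom_def)

lemma (in group) auto_group_hom: "h \<in> auto G \<Longrightarrow> group_hom G G h"
  by unfold_locales (simp add: auto_def)

lemma AutoGroup_carrier: "carrier (AutoGroup A) = auto A"
  by (simp add: AutoGroup_def)

lemma AutoGroup_mult:
  "h \<in> auto A \<Longrightarrow> k \<in> auto A \<Longrightarrow> h \<otimes>\<^bsub>AutoGroup A\<^esub> k = compose (carrier A) h k"
  by (simp add: AutoGroup_def BijGroup_def auto_def)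

lemma AutoGroup_one: "\<one>\<^bsub>AutoGroup A\<^esub> = (\<lambda>a\<in>carrier A. a)"
  by (simp add: AutoGroup_def BijGroup_def)

lemma (in group) AutoGroup_inv_apply:
  assumes "h \<in> auto G" "a \<in> carrier G"
  shows "(inv\<^bsub>AutoGroup G\<^esub> h) (h a) = a"
proof -
  interpret Aut: group "AutoGroup G" by (rule AutoGroup)
  have "inv\<^bsub>AutoGroup G\<^esub> h \<in> auto G"
    using Aut.inv_closed assms(1) by (simp add: AutoGroup_carrier)
  then have "compose (carrier G) (inv\<^bsub>AutoGroup G\<^esub> h) h = (\<lambda>a\<in>carrier G. a)"
    using Aut.l_inv[of h] assms(1) by (simp add: AutoGroup_carrier AutoGroup_mult AutoGroup_one)
  from fun_cong[OF this, of a] show ?thesis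
    using assms(2) by (simp add: compose_def)
qed

text \<open>Commutativity makes \<open>a\<close> to \<open>h a \<otimes> inv a\<close> a
  homomorphism for each \<open>h\<close>, and level \<open>k + 1\<close> is an intersection of
  preimages of level \<open>k\<close>.\<close>

lemma (in comm_group) subgroup_upper_fixed:
  assumes "H \<subseteq> auto G"
  shows "subgroup (upper_fixed G H k) G"
proof (induction k)
  case 0
  show ?case by (simp add: triv_subgroup)
next
  case (Suc k)
  let ?Z = "upper_fixed G H k"
  interpret Z: subgroup ?Z G by (rule Suc)
  have H: "group_hom G G h" if "h \<in> H" for h
    using assms that by (blast intro: auto_group_hom)
  show ?case
  proof (rule subgroup.intro)
    show "upper_fixed G H (Suc k) \<subseteq> carrier G" by auto
  next
    fix a b assume a: "a \<in> upper_fixed G H (Suc k)" and b: "b \<in> upper_fixed G H (Suc k)"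
    have "h (a \<otimes> b) \<otimes> inv (a \<otimes> b) \<in> ?Z" if h: "h \<in> H" for h
    proof -
      interpret h: group_hom G G h by (rule H[OF h])
      have "h (a \<otimes> b) \<otimes> inv (a \<otimes> b) = (h a \<otimes> inv a) \<otimes> (h b \<otimes> inv b)"
        using a b by (simp add: inv_mult m_ac)
      then show ?thesis using a b h Z.m_closed by simp
    qed
    then show "a \<otimes> b \<in> upper_fixed G H (Suc k)" using a b by simp
  next
    have "h \<one> \<otimes> inv \<one> \<in> ?Z" if h: "h \<in> H" for h
    proof -
      interpret h: group_hom G G h by (rule H[OF h])
      show ?thesis by simp
    qed
    then show "\<one> \<in> upper_fixed G H (Suc k)" by simp
  next
    fix a assume a: "a \<in> upper_fixed G H (Suc k)"
    have "h (inv a) \<otimes> inv (inv a) \<in> ?Z" if h: "h \<in> H" for h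
    proof -
      interpret h: group_hom G G h by (rule H[OF h])
      have "h (inv a) \<otimes> inv (inv a) = inv (h a \<otimes> inv a)"
        using a by (simp add: inv_mult)
      then show ?thesis using a h Z.m_inv_closed by simp
    qed
    then show "inv a \<in> upper_fixed G H (Suc k)" using a by simp
  qed
qed

lemma (in comm_group) upper_fixed_mono_Suc:
  assumes "H \<subseteq> auto G"
  shows "upper_fixed G H k \<subseteq> upper_fixed G H (Suc k)"
proof (induction k)
  case 0
  show ?case
    using subgroup.one_closed[OF subgroup_upper_fixed[OF assms, of 1]] by simp
next
  case (Suc k)
  show ?case
  proof
    fix a assume "a \<in> upper_fixed G H (Suc k)"
    then have "a \<in> carrier G" "\<forall>h\<in>H. h a \<otimes> inv a \<in> upper_fixed G H k"
      by simp_all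
    then show "a \<in> upper_fixed G H (Suc (Suc k))"
      using Suc by (subst upper_fixed.simps(2)) blast
  qed
qed

text \<open>Additively, \<open>h z = (h z - z) + z\<close>. Regarding \<open>z\<close> as an element
  of level \<open>k + 1\<close> puts \<open>h z - z\<close> into level \<open>k\<close> without a
  separate case \<open>k = 0\<close>.\<close>

lemma (in comm_group) upper_fixed_invariant:
  assumes "H \<subseteq> auto G" "h \<in> H" "z \<in> upper_fixed G H k"
  shows "h z \<in> upper_fixed G H k"
proof -
  interpret Z: subgroup "upper_fixed G H k" G by (rule subgroup_upper_fixed[OF assms(1)])
  have z: "z \<in> carrier G" using assms(3) by (rule Z.mem_carrier)
  have hz: "h z \<in> carrier G" using auto_closed[OF subsetD[OF assms(1,2)] z] .
  have "z \<in> upper_fixed G H (Suc k)"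
    by (rule subsetD[OF upper_fixed_mono_Suc[OF assms(1)] assms(3)])
  then have "h z \<otimes> inv z \<in> upper_fixed G H k"
    using assms(2) by simp
  then have "h z \<otimes> inv z \<otimes> z \<in> upper_fixed G H k" using assms(3) by (rule Z.m_closed)
  then show ?thesis using z hz by (simp add: m_assoc)
qed

text \<open>Testing generators suffices: \<open>h1 h2 - 1 = h1 (h2 - 1) + (h1 - 1)\<close> and
  \<open>inv h - 1 = - inv h (h - 1)\<close>, where level \<open>k\<close> is a subgroup invariant
  under \<open>H\<close>.\<close>

lemma (in comm_group) upper_fixed_Suc_generate:
  assumes S: "S \<subseteq> auto G" and H: "H = generate (AutoGroup G) S" and a: "a \<in> carrier G"
    and gen: "\<And>h. h \<in> S \<Longrightarrow> h a \<otimes> inv a \<in> upper_fixed G H k"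
  shows "a \<in> upper_fixed G H (Suc k)"
proof -
  interpret Aut: group "AutoGroup G" by (rule AutoGroup)
  let ?Z = "upper_fixed G H k"
  have HA: "H \<subseteq> auto G"
    using Aut.generate_incl[of S] S by (simp add: H AutoGroup_carrier)
  interpret Z: subgroup ?Z G by (rule subgroup_upper_fixed[OF HA])
  have "h a \<otimes> inv a \<in> ?Z" if "h \<in> generate (AutoGroup G) S" for h
    using that
  proof (induction rule: generate.induct)
    case one
    then show ?case using a by (simp add: AutoGroup_one)
  next
    case (incl h)
    then show ?case by (rule gen)
  next
    case (inv h)
    let ?k = "inv\<^bsub>AutoGroup G\<^esub> h"
    let ?z = "h a \<otimes> inv a"
    have h: "h \<in> auto G" using inv S by blast
    have k: "?k \<in> auto G"
      using Aut.inv_closed h by (simp add: AutoGroup_carrier)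
    interpret k: group_hom G G ?k using k by (rule auto_group_hom)
    have ha: "h a \<in> carrier G" using h a by (rule auto_closed)
    have kH: "?k \<in> H" using inv by (simp add: H generate.inv)
    have "?k ?z \<in> ?Z" using upper_fixed_invariant[OF HA kH gen[OF inv]] .
    moreover have "?k ?z = a \<otimes> inv (?k a)"
      using a ha AutoGroup_inv_apply[OF h a] by simp
    ultimately have "inv (a \<otimes> inv (?k a)) \<in> ?Z" using Z.m_inv_closed by simp
    then show ?case using a by (simp add: inv_mult m_comm)
  next
    case (eng h1 h2)
    have h: "h1 \<in> H" "h1 \<in> auto G" "h2 \<in> auto G"
      using eng.hyps HA by (simp_all add: H subset_iff)
    have c: "h1 a \<in> carrier G" "h2 a \<in> carrier G" "h1 (h2 a) \<in> carrier G"
      using h(2,3) a by (simp_all add: auto_closed)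
    interpret h1: group_hom G G h1 using h(2) by (rule auto_group_hom)
    have "(h1 \<otimes>\<^bsub>AutoGroup G\<^esub> h2) a \<otimes> inv a = h1 (h2 a) \<otimes> inv a"
      using h(2,3) a by (simp add: AutoGroup_mult compose_def)
    also have "\<dots> = h1 (h2 a \<otimes> inv a) \<otimes> (h1 a \<otimes> inv a)"
      using a c by (simp add: m_assoc) (simp add: m_assoc[symmetric])
    also have "\<dots> \<in> ?Z"
      by (intro Z.m_closed upper_fixed_invariant[OF HA h(1)] eng.IH)
    finally show ?case .
  qed
  then show ?thesis using a by (simp add: H)
qed

section \<open>Commuting unipotent automorphisms\<close>

text \<open>An element killed by \<open>T\<^sub>i - 1\<close> for all \<open>i\<close> outside \<open>S\<close> is sent by \<open>T\<^sub>i - 1\<close>, \<open>i \<in> S\<close>, to one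
  killed outside \<open>S - {i}\<close>; hence the induction on \<open>S\<close>.\<close>

lemma (in comm_group) mem_upper_fixed_card:
  assumes T: "\<And>i. i \<in> I \<Longrightarrow> T i \<in> auto G"
    and H: "H = generate (AutoGroup G) (T ` I)"
    and comm: "\<And>i j a. i \<in> I \<Longrightarrow> j \<in> I \<Longrightarrow> a \<in> carrier G \<Longrightarrow> T i (T j a) = T j (T i a)"
    and unip: "\<And>i a. i \<in> I \<Longrightarrow> a \<in> carrier G \<Longrightarrow> T i (T i a \<otimes> inv a) = T i a \<otimes> inv a"
    and S: "finite S" "S \<subseteq> I" and a: "a \<in> carrier G"
    and fixed: "\<And>i. i \<in> I - S \<Longrightarrow> T i a = a"
  shows "a \<in> upper_fixed G H (Suc (card S))"
proof -
  have TA: "T ` I \<subseteq> auto G" using T by blast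
  have HA: "H \<subseteq> auto G"
    using group.generate_incl[OF AutoGroup, of "T ` I"] TA by (simp add: H AutoGroup_carrier)
  show ?thesis
    using S a fixed
  proof (induction "card S" arbitrary: S a)
    case 0
    then have S: "S = {}" by simp
    have "T i a \<otimes> inv a \<in> upper_fixed G H 0" if "i \<in> I" for i
      using 0(4,5) that by (simp add: S)
    then show ?case
      unfolding S card.empty by (intro upper_fixed_Suc_generate[OF TA H 0(4)]) (erule imageE, simp)
  next
    case (Suc n)
    have "T i a \<otimes> inv a \<in> upper_fixed G H (card S)" if i: "i \<in> I" for i
    proof (cases "i \<in> S")
      case False
      then show ?thesis
        using Suc.prems i subgroup.one_closed[OF subgroup_upper_fixed[OF HA]] by simp
    next
      case True
      let ?b = "T i a \<otimes> inv a"
      have c: "T j a \<in> carrier G" if "j \<in> I" for j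
        using T that Suc.prems(3) by (blast intro: auto_closed)
      have n: "n = card (S - {i})" using True Suc by simp
      \<comment> \<open>For \<open>j = i\<close> this is the unipotence of \<open>T i\<close>. Any
        other such \<open>j\<close> lies outside \<open>S\<close>, so \<open>T j\<close> fixes
        \<open>a\<close>; since it commutes with \<open>T i\<close>, it fixes \<open>?b\<close> as
        well.\<close>
      have "T j ?b = ?b" if j: "j \<in> I - (S - {i})" for j
      proof (cases "j = i")
        case True
        then show ?thesis using i Suc.prems unip by simp
      next
        case False
        then have ja: "T j a = a" and jI: "j \<in> I" using j Suc.prems by auto
        interpret Tj: group_hom G G "T j" using T[OF jI] by (rule auto_group_hom)
        show ?thesis
          using comm[OF jI i Suc.prems(3)] ja c[OF i] Suc.prems(3) by simp
      qed
      moreover have "finite (S - {i})" "S - {i} \<subseteq> I" "?b \<in> carrier G"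
        using Suc.prems(1-3) c[OF i] by auto
      ultimately have "?b \<in> upper_fixed G H (Suc (card (S - {i})))"
        by (intro Suc.hyps(1)[OF n])
      then show ?thesis using n Suc.hyps(2) by metis
    qed
    then show ?case
      by (intro upper_fixed_Suc_generate[OF TA H Suc.prems(3)]) (erule imageE, simp)
  qed
qed

text \<open>Taking \<open>S = I\<close> leaves no index outside \<open>S\<close>, so the fixed-point
  condition on \<open>a\<close> is vacuous.\<close>

lemma (in comm_group) upper_fixed_Suc_card:
  assumes "\<And>i. i \<in> I \<Longrightarrow> T i \<in> auto G"
    and "H = generate (AutoGroup G) (T ` I)"
    and "\<And>i j a. i \<in> I \<Longrightarrow> j \<in> I \<Longrightarrow> a \<in> carrier G \<Longrightarrow> T i (T j a) = T j (T i a)"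
    and "\<And>i a. i \<in> I \<Longrightarrow> a \<in> carrier G \<Longrightarrow> T i (T i a \<otimes> inv a) = T i a \<otimes> inv a"
    and "finite I"
  shows "upper_fixed G H (Suc (card I)) = carrier G"
proof
  show "carrier G \<subseteq> upper_fixed G H (Suc (card I))"
  proof
    fix a assume "a \<in> carrier G"
    with assms show "a \<in> upper_fixed G H (Suc (card I))"
      by (intro mem_upper_fixed_card[where I = I and T = T]) simp_all
  qed
  show "upper_fixed G H (Suc (card I)) \<subseteq> carrier G" by simp
qed

section \<open>Conjugation on a quotient of normal subgroups\<close>

locale normal_pair = group G for G (structure) +
  fixes N M
  assumes N: "N \<lhd> G" and M: "M \<lhd> G" and M_subset: "M \<subseteq> N"
begin

sublocale N: normal N G by (rule N)
sublocale M: normal M G by (rule M)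

lemma normal_M_N: "M \<lhd> G\<lparr>carrier := N\<rparr>"
  using normal_restrict_supergroup[OF N.subgroup_axioms M M_subset] .

lemma group_subquotient: "group (subquotient G N M)"
  unfolding subquotient_def by (rule normal.factorgroup_is_group[OF normal_M_N])

lemma carrier_subquotient: "carrier (subquotient G N M) = (\<lambda>n. M #> n) ` N"
  by (simp add: subquotient_def carrier_FactGroup r_coset_def)

lemma coset_in_subquotient: "n \<in> N \<Longrightarrow> M #> n \<in> carrier (subquotient G N M)"
  by (simp add: carrier_subquotient)

lemma subquotient_one: "\<one>\<^bsub>subquotient G N M\<^esub> = M"
  by (simp add: subquotient_def)

lemma subquotient_mult:
  "n \<in> N \<Longrightarrow> m \<in> N \<Longrightarrow> (M #> n) \<otimes>\<^bsub>subquotient G N M\<^esub> (M #> m) = M #> (n \<otimes> m)"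
  using M.rcos_sum[of n m] by (simp add: subquotient_def set_mult_def)

lemma subquotient_inv:
  assumes "n \<in> N" shows "inv\<^bsub>subquotient G N M\<^esub> (M #> n) = M #> inv n"
proof -
  interpret A: group "subquotient G N M" by (rule group_subquotient)
  show ?thesis
    using assms
    by (intro A.inv_equality)
      (simp_all add: coset_in_subquotient subquotient_mult subquotient_one coset_mult_one M.subset)
qed

lemma conj_in_N: "g \<in> carrier G \<Longrightarrow> n \<in> N \<Longrightarrow> g \<otimes> n \<otimes> inv g \<in> N"
  by (rule N.inv_op_closed2)

text \<open>Normality of \<open>M\<close> turns \<open>g <# M\<close> into \<open>M #> g\<close>, so
  the action can be computed on representatives.\<close>

lemma conj_action_coset:
  assumes "g \<in> carrier G" "n \<in> N"
  shows "conj_action G N M g (M #> n) = M #> (g \<otimes> n \<otimes> inv g)"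
proof -
  have n: "n \<in> carrier G" using assms by simp
  have "(g <# (M #> n)) #> inv g = g <# ((M #> n) #> inv g)"
    using assms n M.subset by (intro coset_assoc[symmetric] r_coset_subset_G) simp_all
  also have "\<dots> = g <# (M #> (n \<otimes> inv g))"
    using assms n M.subset by (simp add: coset_mult_assoc)
  also have "\<dots> = (g <# M) #> (n \<otimes> inv g)"
    using assms n M.subset by (intro coset_assoc) auto
  also have "g <# M = M #> g"
    using M.coset_eq assms by simp
  also have "(M #> g) #> (n \<otimes> inv g) = M #> (g \<otimes> n \<otimes> inv g)"
    using assms n M.subset by (simp add: coset_mult_assoc m_assoc)
  finally show ?thesis
    using assms by (simp add: conj_action_def coset_in_subquotient)
qed

lemma conj_action_closed:
  "g \<in> carrier G \<Longrightarrow> C \<in> carrier (subquotient G N M) \<Longrightarrow>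
    conj_action G N M g C \<in> carrier (subquotient G N M)"
  by (auto simp: carrier_subquotient conj_action_coset conj_in_N)

text \<open>The form with two elements of product 1 yields both inverse laws for conjugation by
  \<open>g\<close> and by \<open>inv g\<close>.\<close>

lemma conj_action_inverse:
  assumes "g \<in> carrier G" "h \<in> carrier G" "g \<otimes> h = \<one>" "C \<in> carrier (subquotient G N M)"
  shows "conj_action G N M g (conj_action G N M h C) = C"
proof -
  obtain n where n: "n \<in> N" "C = M #> n" using assms(4) by (auto simp: carrier_subquotient)
  have "g \<otimes> (h \<otimes> n \<otimes> inv h) \<otimes> inv g = (g \<otimes> h) \<otimes> n \<otimes> inv (g \<otimes> h)"
    using n(1) assms(1,2) by (simp add: inv_mult_group m_assoc)
  also have "\<dots> = n" using n(1) assms(3) by simp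
  finally show ?thesis
    using n assms by (simp add: conj_action_coset conj_in_N)
qed

lemma conj_action_auto:
  assumes g: "g \<in> carrier G"
  shows "conj_action G N M g \<in> auto (subquotient G N M)"
proof -
  let ?A = "subquotient G N M"
  have "conj_action G N M g \<in> hom ?A ?A"
  proof (rule homI)
    fix C D assume "C \<in> carrier ?A" "D \<in> carrier ?A"
    then obtain n m where n: "n \<in> N" "C = M #> n" and m: "m \<in> N" "D = M #> m"
      by (auto simp: carrier_subquotient)
    have "(g \<otimes> n \<otimes> inv g) \<otimes> (g \<otimes> m \<otimes> inv g) = g \<otimes> (n \<otimes> m) \<otimes> inv g"
      using g n(1) m(1) by (simp add: m_assoc inv_solve_left) (simp add: m_assoc[symmetric])
    then show "conj_action G N M g (C \<otimes>\<^bsub>?A\<^esub> D) =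
        conj_action G N M g C \<otimes>\<^bsub>?A\<^esub> conj_action G N M g D"
      using g n m by (simp add: subquotient_mult conj_action_coset conj_in_N)
  qed (use g in \<open>rule conj_action_closed\<close>)
  moreover have "bij_betw (conj_action G N M g) (carrier ?A) (carrier ?A)"
    using g by (intro bij_betwI[where g = "conj_action G N M (inv g)"])
      (auto simp: conj_action_closed conj_action_inverse)
  \<comment> \<open>What remains after the homomorphism and bijection properties is extensionality,
    which holds because \<open>conj_action\<close> is a restricted function.\<close>
  ultimately show ?thesis
    by (simp add: auto_def Bij_def) (simp add: conj_action_def)
qed

text \<open>The coset of \<open>g \<otimes> n \<otimes> inv g \<otimes> inv n\<close> is the coset
  of \<open>n\<close> with the operator of \<open>g\<close> minus 1 applied to it. Each commutation
  with \<open>G\<close> thus lowers the level by one: at stage \<open>i\<close> the cosets lie in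
  level \<open>k - i\<close>, and level 0 is the trivial coset.\<close>

lemma rel_lower_central_upper_fixed:
  assumes A: "comm_group (subquotient G N M)" and K: "K \<subseteq> N"
    and "\<And>n. n \<in> K \<Longrightarrow> M #> n \<in>
           upper_fixed (subquotient G N M) (conj_action G N M ` carrier G) k"
  shows "rel_lower_central G K k \<subseteq> M"
proof -
  let ?A = "subquotient G N M" and ?H = "conj_action G N M ` carrier G"
  interpret A: comm_group ?A by (rule A)
  have H: "?H \<subseteq> auto ?A" using conj_action_auto by blast
  have "rel_lower_central G K i \<subseteq> {n \<in> N. M #> n \<in> upper_fixed ?A ?H (k - i)}"
    if "i \<le> k" for i
    using that
  proof (induction i)
    case 0
    then show ?case using assms by auto
  next
    case (Suc i)
    let ?Z = "upper_fixed ?A ?H (k - Suc i)"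
    let ?U = "{n \<in> N. M #> n \<in> ?Z}"
    have ki: "k - i = Suc (k - Suc i)" using Suc.prems by simp
    interpret Z: subgroup ?Z ?A by (rule A.subgroup_upper_fixed[OF H])
    \<comment> \<open>The next term is generated by commutators; once \<open>?U\<close> is a
      subgroup, only these generators need checking.\<close>
    have "subgroup ?U G"
    proof (rule subgroup.intro)
      show "\<one> \<in> ?U"
        using Z.one_closed by (simp add: subquotient_one coset_mult_one M.subset)
    next
      fix n m assume "n \<in> ?U" "m \<in> ?U"
      then show "n \<otimes> m \<in> ?U"
        using Z.m_closed[of "M #> n" "M #> m"] by (simp add: subquotient_mult)
    next
      fix n assume "n \<in> ?U"
      then show "inv n \<in> ?U"
        using Z.m_inv_closed[of "M #> n"] by (simp add: subquotient_inv)
    qed auto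
    moreover have "g \<otimes> n \<otimes> inv g \<otimes> inv n \<in> ?U"
      if g: "g \<in> carrier G" and n: "n \<in> rel_lower_central G K i" for g n
    proof -
      have nN: "n \<in> N" "M #> n \<in> upper_fixed ?A ?H (Suc (k - Suc i))"
        using Suc n ki by auto
      then have "conj_action G N M g (M #> n) \<otimes>\<^bsub>?A\<^esub> inv\<^bsub>?A\<^esub> (M #> n) \<in> ?Z"
        using g by simp
      then show ?thesis
        using g nN(1) conj_in_N[OF g nN(1)]
        by (simp add: conj_action_coset subquotient_inv subquotient_mult)
    qed
    ultimately show ?case
      unfolding rel_lower_central.simps commutator_subgroup_def
      by (intro generate_subgroup_incl) auto
  qed
  from this[of k] have "rel_lower_central G K k \<subseteq> {n \<in> N. M #> n = M}"
    by (simp add: subquotient_one)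
  then show ?thesis
    using coset_join1[OF _ _ M.subgroup_axioms] by auto
qed

end

section \<open>Splitting the relative lower central series\<close>

text \<open>The recursion remembers only its current term, so a long run of steps can be cut into
  blocks, one for each layer of the normal series.\<close>

lemma rel_lower_central_add:
  "rel_lower_central G K (i + k) = rel_lower_central G (rel_lower_central G K i) k"
  by (induction k) auto

lemma (in group) rel_lower_central_mono:
  assumes "K \<subseteq> L"
  shows "rel_lower_central G K k \<subseteq> rel_lower_central G L k"
proof (induction k)
  case (Suc k)
  then show ?case
    unfolding rel_lower_central.simps commutator_subgroup_def
    by (intro mono_generate) blast
qed (use assms in simp)

section \<open>Conjugates of the symmetries of a quandle\<close>

text \<open>As a quandle homomorphism, \<open>\<phi>\<close> satisfies
  \<open>\<phi> s\<^sub>x = s\<^sub>y \<phi>\<close> with \<open>y = \<phi> x\<close>; this is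
  solved for \<open>s\<^sub>y\<close>.\<close>

lemma (in quandle) sym_perm_conj:
  assumes \<phi>: "\<phi> \<in> carrier (Inn Q)" and x: "x \<in> carrier Q"
  shows "sym_perm Q (\<phi> x) = \<phi> \<otimes>\<^bsub>Inn Q\<^esub> sym_perm Q x \<otimes>\<^bsub>Inn Q\<^esub> inv\<^bsub>Inn Q\<^esub> \<phi>"
proof -
  interpret G: group "Inn Q" by (rule group_Inn)
  have hom: "\<phi> \<in> quandle_hom Q Q"
    using \<phi> Inn_subset_Aut by (auto simp: quandle_Aut_def)
  have \<phi>x: "\<phi> x \<in> carrier Q" using hom x by (auto simp: quandle_hom_def)
  have "\<phi> \<otimes>\<^bsub>Inn Q\<^esub> sym_perm Q x = sym_perm Q (\<phi> x) \<otimes>\<^bsub>Inn Q\<^esub> \<phi>"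
    using \<phi> x \<phi>x hom
    by (simp add: Inn_mult sym_perm_in_Inn)
      (auto simp: compose_def sym_perm_def quandle_hom_def fun_eq_iff qsym_closed)
  then show ?thesis
    using \<phi> x \<phi>x by (simp add: G.inv_solve_right sym_perm_in_Inn)
qed

text \<open>Regrouping gives \<open>c = s \<otimes> inv t\<close>, where \<open>t\<close> is the
  conjugate of \<open>s\<close> by \<open>\<phi>\<close>, that is, the symmetry at
  \<open>\<phi> x\<close>. Operator-reducedness makes \<open>s\<close> commute with
  \<open>t\<close>, hence with \<open>c\<close>.\<close>

lemma operator_reduced_commutes_commutator:
  assumes f: "operator_reduced P Q f" and x: "x \<in> carrier P" and \<phi>: "\<phi> \<in> Inn_rel P Q f"
  defines "s \<equiv> sym_perm P x"
  defines "c \<equiv> s \<otimes>\<^bsub>Inn P\<^esub> \<phi> \<otimes>\<^bsub>Inn P\<^esub> inv\<^bsub>Inn P\<^esub> s \<otimes>\<^bsub>Inn P\<^esub> inv\<^bsub>Inn P\<^esub> \<phi>"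
  shows "s \<otimes>\<^bsub>Inn P\<^esub> c \<otimes>\<^bsub>Inn P\<^esub> inv\<^bsub>Inn P\<^esub> s = c"
proof -
  interpret P: quandle P using f by (simp add: operator_reduced_def quandle_epi_def)
  interpret G: group "Inn P" by (rule P.group_Inn)
  have s: "s \<in> carrier (Inn P)" using x by (simp add: s_def P.sym_perm_in_Inn)
  have p: "\<phi> \<in> carrier (Inn P)" using \<phi> by (simp add: Inn_rel_def kernel_def)
  define t where "t = \<phi> \<otimes>\<^bsub>Inn P\<^esub> s \<otimes>\<^bsub>Inn P\<^esub> inv\<^bsub>Inn P\<^esub> \<phi>"
  have t: "t \<in> carrier (Inn P)" using s p by (simp add: t_def)
  have "t = sym_perm P (\<phi> x)"
    using P.sym_perm_conj[OF p x] by (simp add: s_def t_def)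
  then have "s \<otimes>\<^bsub>Inn P\<^esub> t = t \<otimes>\<^bsub>Inn P\<^esub> s"
    using f x \<phi> by (simp add: operator_reduced_def s_def)
  then have st: "inv\<^bsub>Inn P\<^esub> t \<otimes>\<^bsub>Inn P\<^esub> inv\<^bsub>Inn P\<^esub> s = inv\<^bsub>Inn P\<^esub> s \<otimes>\<^bsub>Inn P\<^esub> inv\<^bsub>Inn P\<^esub> t"
    using s t by (metis G.inv_mult_group)
  have c: "c = s \<otimes>\<^bsub>Inn P\<^esub> inv\<^bsub>Inn P\<^esub> t"
    using s p by (simp add: c_def t_def G.inv_mult_group G.m_assoc)
  have "s \<otimes>\<^bsub>Inn P\<^esub> c \<otimes>\<^bsub>Inn P\<^esub> inv\<^bsub>Inn P\<^esub> s
      = s \<otimes>\<^bsub>Inn P\<^esub> (s \<otimes>\<^bsub>Inn P\<^esub> (inv\<^bsub>Inn P\<^esub> t \<otimes>\<^bsub>Inn P\<^esub> inv\<^bsub>Inn P\<^esub> s))"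
    using s t by (simp add: c G.m_assoc)
  also have "\<dots> = s \<otimes>\<^bsub>Inn P\<^esub> (s \<otimes>\<^bsub>Inn P\<^esub> inv\<^bsub>Inn P\<^esub> s \<otimes>\<^bsub>Inn P\<^esub> inv\<^bsub>Inn P\<^esub> t)"
    using s t by (simp only: st) (simp add: G.m_assoc[symmetric])
  also have "\<dots> = c" using s t by (simp add: c)
  finally show ?thesis .
qed

section \<open>Descent through the layers of the normal series\<close>

theorem theorem4p21:
  fixes P :: "('a, 'm) qdl_scheme" and Q :: "('b, 'n) qdl_scheme" and f :: "'a \<Rightarrow> 'b"
    and N :: "nat \<Rightarrow> ('a \<Rightarrow> 'a) set" and d r :: nat
  assumes "operator_reduced P Q f"
    and "N 0 = {\<one>\<^bsub>Inn P\<^esub>}"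
    and "N d = Inn_rel P Q f"
    and "\<And>j. j < d \<Longrightarrow> N j \<subseteq> N (Suc j)"
    and "\<And>j. j \<le> d \<Longrightarrow> N j \<lhd> Inn P"
    and "\<And>j. j \<in> {1..d} \<Longrightarrow> comm_group (subquotient (Inn P) (N j) (N (j - 1)))"
    and "\<And>j. j \<in> {1..d} \<Longrightarrow>
           comm_group (AutoGroup (subquotient (Inn P) (N j) (N (j - 1)))
             \<lparr>carrier := conj_action (Inn P) (N j) (N (j - 1)) ` carrier (Inn P)\<rparr>)"
    and "\<And>j. j \<in> {1..d} \<Longrightarrow>
           \<exists>x. (\<forall>i\<in>{1..r}. x i \<in> carrier P) \<and>
             conj_action (Inn P) (N j) (N (j - 1)) ` carrier (Inn P) =
             generate (AutoGroup (subquotient (Inn P) (N j) (N (j - 1))))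
               ((\<lambda>i. conj_action (Inn P) (N j) (N (j - 1)) (sym_perm P (x i))) ` {1..r})"
  shows "nilpotent_of_class_le P Q f (d * (r + 1))"
proof -
  let ?G = "Inn P" and ?R = "Inn_rel P Q f"
  have epi: "quandle_epi P Q f" using assms(1) by (simp add: operator_reduced_def)
  interpret P: quandle P using epi by (simp add: quandle_epi_def)
  interpret G: group ?G by (rule P.group_Inn)
  have N_le: "N i \<subseteq> N j" if "i \<le> j" "j \<le> d" for i j
    using that
  proof (induction j rule: dec_induct)
    case (step n)
    then show ?case using assms(4)[of n] by simp
  qed simp
  have step: "rel_lower_central ?G (N (Suc j)) (r + 1) \<subseteq> N j" if j: "j < d" for j
  proof -
    let ?N = "N (Suc j)" and ?M = "N j"
    let ?A = "subquotient ?G ?N ?M"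
    let ?\<alpha> = "conj_action ?G ?N ?M"
    let ?H = "?\<alpha> ` carrier ?G"
    \<comment> \<open>The layer is counted from \<open>j = 0\<close>, so the hypotheses are used at
      \<open>Suc j\<close>, where their \<open>j - 1\<close> becomes \<open>j\<close>.\<close>
    have j': "Suc j \<in> {1..d}" using j by simp
    interpret NM: normal_pair ?G ?N ?M
      using j assms(4,5) by (intro normal_pair.intro normal_pair_axioms.intro G.is_group) simp_all
    interpret A: comm_group ?A using assms(6)[OF j'] by simp
    interpret H: comm_group "AutoGroup ?A\<lparr>carrier := ?H\<rparr>" using assms(7)[OF j'] by simp
    obtain x where x: "\<And>i. i \<in> {1..r} \<Longrightarrow> x i \<in> carrier P"
      and gen: "?H = generate (AutoGroup ?A) ((\<lambda>i. ?\<alpha> (sym_perm P (x i))) ` {1..r})"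
      using assms(8)[OF j'] unfolding diff_Suc_1 by blast
    let ?T = "\<lambda>i. ?\<alpha> (sym_perm P (x i))"
    have s: "sym_perm P (x i) \<in> carrier ?G" if "i \<in> {1..r}" for i
      using x that P.sym_perm_in_Inn by blast
    have T: "?T i \<in> auto ?A" if "i \<in> {1..r}" for i
      using NM.conj_action_auto[OF s[OF that]] .
    \<comment> \<open>Indexing by \<open>{1..r}\<close> instead of by the set of operators allows
      repetitions among the \<open>x i\<close> and gives exactly \<open>r + 1\<close>
      levels.\<close>
    have "upper_fixed ?A ?H (Suc (card {1..r})) = carrier ?A"
    proof (rule A.upper_fixed_Suc_card[OF T gen])
      fix i k a assume i: "i \<in> {1..r}" and k: "k \<in> {1..r}" and a: "a \<in> carrier ?A"
      have "compose (carrier ?A) (?T i) (?T k) = compose (carrier ?A) (?T k) (?T i)"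
        using H.m_comm[of "?T i" "?T k"] s i k T by (simp add: AutoGroup_mult)
      from fun_cong[OF this, of a] show "?T i (?T k a) = ?T k (?T i a)"
        using a by (simp add: compose_def)
    next
      fix i a assume i: "i \<in> {1..r}" and a: "a \<in> carrier ?A"
      let ?s = "sym_perm P (x i)"
      obtain n where n: "n \<in> ?N" and an: "a = ?M #>\<^bsub>?G\<^esub> n"
        using a by (auto simp: NM.carrier_subquotient)
      let ?c = "?s \<otimes>\<^bsub>?G\<^esub> n \<otimes>\<^bsub>?G\<^esub> inv\<^bsub>?G\<^esub> ?s \<otimes>\<^bsub>?G\<^esub> inv\<^bsub>?G\<^esub> n"
      \<comment> \<open>Operator-reducedness applies only to relative inner automorphisms; each term
        of the series lies in the last one, which is \<open>?R\<close>.\<close>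
      have "n \<in> ?R" using n N_le[of "Suc j" d] j assms(3) by auto
      then have "?s \<otimes>\<^bsub>?G\<^esub> ?c \<otimes>\<^bsub>?G\<^esub> inv\<^bsub>?G\<^esub> ?s = ?c"
        using operator_reduced_commutes_commutator[OF assms(1) x[OF i]] by blast
      moreover have "?c \<in> ?N" using NM.conj_in_N[OF s[OF i] n] n by simp
      moreover have "?T i a \<otimes>\<^bsub>?A\<^esub> inv\<^bsub>?A\<^esub> a = ?M #>\<^bsub>?G\<^esub> ?c"
        using NM.conj_in_N[OF s[OF i] n] n s[OF i]
        by (simp add: an NM.conj_action_coset NM.subquotient_inv NM.subquotient_mult)
      ultimately show "?T i (?T i a \<otimes>\<^bsub>?A\<^esub> inv\<^bsub>?A\<^esub> a) = ?T i a \<otimes>\<^bsub>?A\<^esub> inv\<^bsub>?A\<^esub> a"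
        using NM.conj_action_coset[OF s[OF i]] by simp
    qed simp_all
    then have "upper_fixed ?A ?H (r + 1) = carrier ?A" by simp
    then show ?thesis
      by (intro NM.rel_lower_central_upper_fixed A.comm_group_axioms subset_refl)
        (simp only: NM.coset_in_subquotient)
  qed
  have "rel_lower_central ?G (N j) (j * (r + 1)) \<subseteq> N 0" if "j \<le> d" for j
    using that
  proof (induction j)
    case (Suc j)
    \<comment> \<open>The first \<open>r + 1\<close> steps cross the top layer; by monotonicity the
      remaining \<open>j * (r + 1)\<close> steps may start from all of \<open>N j\<close>.\<close>
    have "rel_lower_central ?G (N (Suc j)) (Suc j * (r + 1))
        = rel_lower_central ?G (rel_lower_central ?G (N (Suc j)) (r + 1)) (j * (r + 1))"
      by (simp only: mult_Suc rel_lower_central_add)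
    also have "\<dots> \<subseteq> rel_lower_central ?G (N j) (j * (r + 1))"
      using step Suc.prems by (intro G.rel_lower_central_mono) simp
    also have "\<dots> \<subseteq> N 0" using Suc by simp
    finally show ?case .
  qed simp
  from this[of d] have "rel_lower_central ?G ?R (d * (r + 1)) \<subseteq> {\<one>\<^bsub>?G\<^esub>}"
    using assms(2,3) by simp
  \<comment> \<open>Nilpotency is an equality with the trivial subgroup, so the reverse inclusion is
    also required.\<close>
  moreover have "\<one>\<^bsub>?G\<^esub> \<in> rel_lower_central ?G ?R k" for k
  proof (cases k)
    case 0
    have "N d \<lhd> ?G" using assms(5) by simp
    then show ?thesis
      using 0 subgroup.one_closed[OF normal_imp_subgroup, of "N d"] assms(3) by simp
  qed (simp add: commutator_subgroup_def generate.one)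
  ultimately show ?thesis
    using epi by (auto simp: nilpotent_of_class_le_def)
qed

end
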